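(* Work in ZFC and consider transitive-set potentialism $\mathcal{T}=\{W\mid W\text{ is a transitive set}\}$. Every world $W$ obeys $$\mathrm{S4.2}\subseteq\mathrm{Val}_{\mathcal{T}}(W,\mathcal{L}^\Diamond_{\in,W})\subseteq\mathrm{Val}_{\mathcal{T}}(W,\mathcal{L}_\in)\subseteq\mathrm{S5}.$$ Moreover, some worlds $W$ have $\mathrm{S4.2}=\mathrm{Val}_{\mathcal{T}}(W,\mathcal{L}^\Diamond_{\in,W})=\mathrm{Val}_{\mathcal{T}}(W,\mathcal{L}_\in)$.
   Context: $\mathcal{T}$ is the potentialist system whose worlds are all transitive sets (as structures $\langle W,\in\rangle$), with $W$ accessing $U$ iff $W\subseteq U$; $\Diamond\varphi$ at $W$ means $\varphi$ holds at some transitive $U\supseteq W$, $\Box\varphi$ at all such; quantifiers range over the current world. $\mathcal{L}_\in$ is the language of set theory, $\mathcal{L}_\in^\Diamond$ adds modal operators, subscript $W$ allows parameters from $W$. $\mathrm{Val}_{\mathcal{T}}(W,\mathcal{L}')$ is the set of propositional modal formulas all of whose substitution instances by $\mathcal{L}'$-sentences are true at $W$. *)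

theory Defs
  imports Main
begin

section \<open>Propositional modal logic\<close>

datatype pm = PVar nat | PFls | PImp pm pm | PBox pm

abbreviation PNeg :: "pm \<Rightarrow> pm" where "PNeg p \<equiv> PImp p PFls"
abbreviation PDia :: "pm \<Rightarrow> pm" where "PDia p \<equiv> PNeg (PBox (PNeg p))"

text \<open>Boxed formulas count as atoms here, so \<open>taut\<close> consists of all modal substitution
  instances of classical propositional tautologies.\<close>

primrec peval :: "(pm \<Rightarrow> bool) \<Rightarrow> pm \<Rightarrow> bool" where
  "peval v (PVar n) \<longleftrightarrow> v (PVar n)"
| "peval v PFls \<longleftrightarrow> False"
| "peval v (PImp p q) \<longleftrightarrow> (peval v p \<longrightarrow> peval v q)"
| "peval v (PBox p) \<longleftrightarrow> v (PBox p)"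

definition taut :: "pm \<Rightarrow> bool" where
  "taut p \<longleftrightarrow> (\<forall>v. peval v p)"

text \<open>The argument is a set of axiom schemes, given by all their instances; this is why no
  substitution rule is needed.\<close>

inductive_set normal_logic :: "pm set \<Rightarrow> pm set" for Ax :: "pm set" where
  taut: "taut p \<Longrightarrow> p \<in> normal_logic Ax"
| K: "PImp (PBox (PImp p q)) (PImp (PBox p) (PBox q)) \<in> normal_logic Ax"
| ax: "p \<in> Ax \<Longrightarrow> p \<in> normal_logic Ax"
| mp: "PImp p q \<in> normal_logic Ax \<Longrightarrow> p \<in> normal_logic Ax \<Longrightarrow> q \<in> normal_logic Ax"
| nec: "p \<in> normal_logic Ax \<Longrightarrow> PBox p \<in> normal_logic Ax"

definition axT :: "pm set" where "axT = {PImp (PBox p) p | p. True}"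
definition ax4 :: "pm set" where "ax4 = {PImp (PBox p) (PBox (PBox p)) | p. True}"
definition ax2 :: "pm set" where "ax2 = {PImp (PDia (PBox p)) (PBox (PDia p)) | p. True}"
definition ax5 :: "pm set" where "ax5 = {PImp (PDia p) (PBox (PDia p)) | p. True}"

definition S42 :: "pm set" where "S42 = normal_logic (axT \<union> ax4 \<union> ax2)"
definition S5 :: "pm set" where "S5 = normal_logic (axT \<union> ax4 \<union> ax5)"


section \<open>The modal language of set theory, with parameters\<close>

datatype 'v trm = Var nat | Par 'v

datatype 'v fm =
    Mem "'v trm" "'v trm"
  | Eq "'v trm" "'v trm"
  | Fls
  | Imp "'v fm" "'v fm"
  | All nat "'v fm"
  | Box "'v fm"

abbreviation Neg :: "'v fm \<Rightarrow> 'v fm" where "Neg \<phi> \<equiv> Imp \<phi> Fls"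
abbreviation Dia :: "'v fm \<Rightarrow> 'v fm" where "Dia \<phi> \<equiv> Neg (Box (Neg \<phi>))"

primrec tfv :: "'v trm \<Rightarrow> nat set" where
  "tfv (Var n) = {n}"
| "tfv (Par a) = {}"

primrec fv :: "'v fm \<Rightarrow> nat set" where
  "fv (Mem t u) = tfv t \<union> tfv u"
| "fv (Eq t u) = tfv t \<union> tfv u"
| "fv Fls = {}"
| "fv (Imp \<phi> \<psi>) = fv \<phi> \<union> fv \<psi>"
| "fv (All n \<phi>) = fv \<phi> - {n}"
| "fv (Box \<phi>) = fv \<phi>"

text \<open>The parameters of a formula are given by the datatype's set function \<open>set_fm\<close>.\<close>

primrec modal_free :: "'v fm \<Rightarrow> bool" where
  "modal_free (Mem t u) \<longleftrightarrow> True"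
| "modal_free (Eq t u) \<longleftrightarrow> True"
| "modal_free Fls \<longleftrightarrow> True"
| "modal_free (Imp \<phi> \<psi>) \<longleftrightarrow> modal_free \<phi> \<and> modal_free \<psi>"
| "modal_free (All n \<phi>) \<longleftrightarrow> modal_free \<phi>"
| "modal_free (Box \<phi>) \<longleftrightarrow> False"

definition ext :: "('v \<Rightarrow> 'v \<Rightarrow> bool) \<Rightarrow> 'v \<Rightarrow> 'v set" where
  "ext E W = {a. E a W}"

definition trans_set :: "('v \<Rightarrow> 'v \<Rightarrow> bool) \<Rightarrow> 'v \<Rightarrow> bool" where
  "trans_set E W \<longleftrightarrow> (\<forall>x y. E x W \<longrightarrow> E y x \<longrightarrow> E y W)"

primrec tval :: "(nat \<Rightarrow> 'v) \<Rightarrow> 'v trm \<Rightarrow> 'v" where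
  "tval s (Var n) = s n"
| "tval s (Par a) = a"

text \<open>\<open>sat E D s \<phi>\<close>: \<open>\<phi>\<close> holds in the structure with domain \<open>D\<close> and membership \<open>E\<close>. For a world \<open>W\<close>
  the domain is \<open>ext E W\<close> (possibly empty). On modal-free formulas this is Tarskian
  satisfaction, which with \<open>D = UNIV\<close> also serves the axiom schemes of ZFC.\<close>

primrec sat :: "('v \<Rightarrow> 'v \<Rightarrow> bool) \<Rightarrow> 'v set \<Rightarrow> (nat \<Rightarrow> 'v) \<Rightarrow> 'v fm \<Rightarrow> bool" where
  "sat E D s (Mem t u) \<longleftrightarrow> E (tval s t) (tval s u)"
| "sat E D s (Eq t u) \<longleftrightarrow> tval s t = tval s u"
| "sat E D s Fls \<longleftrightarrow> False"
| "sat E D s (Imp \<phi> \<psi>) \<longleftrightarrow> (sat E D s \<phi> \<longrightarrow> sat E D s \<psi>)"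
| "sat E D s (All n \<phi>) \<longleftrightarrow> (\<forall>a\<in>D. sat E D (s(n := a)) \<phi>)"
| "sat E D s (Box \<phi>) \<longleftrightarrow> (\<forall>U. trans_set E U \<and> D \<subseteq> ext E U \<longrightarrow> sat E (ext E U) s \<phi>)"

lemma sat_Dia:
  "sat E D s (Dia \<phi>) \<longleftrightarrow> (\<exists>U. trans_set E U \<and> D \<subseteq> ext E U \<and> sat E (ext E U) s \<phi>)"
  by auto

text \<open>For sentences the choice of the assignment is immaterial.\<close>

definition true_at :: "('v \<Rightarrow> 'v \<Rightarrow> bool) \<Rightarrow> 'v \<Rightarrow> 'v fm \<Rightarrow> bool" where
  "true_at E W \<phi> \<longleftrightarrow> (\<forall>s. sat E (ext E W) s \<phi>)"

definition L_in :: "'v fm set" where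
  "L_in = {\<phi>. fv \<phi> = {} \<and> modal_free \<phi> \<and> set_fm \<phi> = {}}"

definition L_dia_par :: "('v \<Rightarrow> 'v \<Rightarrow> bool) \<Rightarrow> 'v \<Rightarrow> 'v fm set" where
  "L_dia_par E W = {\<phi>. fv \<phi> = {} \<and> set_fm \<phi> \<subseteq> ext E W}"

primrec inst :: "(nat \<Rightarrow> 'v fm) \<Rightarrow> pm \<Rightarrow> 'v fm" where
  "inst \<sigma> (PVar n) = \<sigma> n"
| "inst \<sigma> PFls = Fls"
| "inst \<sigma> (PImp p q) = Imp (inst \<sigma> p) (inst \<sigma> q)"
| "inst \<sigma> (PBox p) = Box (inst \<sigma> p)"

definition Val :: "('v \<Rightarrow> 'v \<Rightarrow> bool) \<Rightarrow> 'v \<Rightarrow> 'v fm set \<Rightarrow> pm set" where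
  "Val E W L = {p. \<forall>\<sigma>. (\<forall>n. \<sigma> n \<in> L) \<longrightarrow> true_at E W (inst \<sigma> p)}"


section \<open>Models of ZFC\<close>

text \<open>First-order ZFC: \<open>E\<close> is an arbitrary, possibly ill-founded, membership relation, and
  the two schemes range over modal-free formulas only, with parameters supplied by the
  assignment \<open>s\<close>.\<close>

locale ZFC =
  fixes E :: "'v \<Rightarrow> 'v \<Rightarrow> bool"
  assumes extensionality: "\<forall>x y. (\<forall>z. E z x \<longleftrightarrow> E z y) \<longrightarrow> x = y"
    and foundation: "\<forall>x. (\<exists>y. E y x) \<longrightarrow> (\<exists>y. E y x \<and> \<not> (\<exists>z. E z y \<and> E z x))"
    and pairing: "\<forall>x y. \<exists>p. \<forall>z. E z p \<longleftrightarrow> z = x \<or> z = y"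
    and union: "\<forall>x. \<exists>u. \<forall>z. E z u \<longleftrightarrow> (\<exists>y. E y x \<and> E z y)"
    and power: "\<forall>x. \<exists>p. \<forall>z. E z p \<longleftrightarrow> (\<forall>w. E w z \<longrightarrow> E w x)"
    and infinity: "\<exists>x. (\<exists>e. E e x \<and> (\<forall>z. \<not> E z e)) \<and>
      (\<forall>y. E y x \<longrightarrow> (\<exists>y'. E y' x \<and> (\<forall>z. E z y' \<longleftrightarrow> E z y \<or> z = y)))"
    and choice: "\<forall>x. (\<forall>y. E y x \<longrightarrow> (\<exists>z. E z y)) \<and>
        (\<forall>y y'. E y x \<and> E y' x \<and> y \<noteq> y' \<longrightarrow> \<not> (\<exists>z. E z y \<and> E z y')) \<longrightarrow>
      (\<exists>c. \<forall>y. E y x \<longrightarrow> (\<exists>!z. E z y \<and> E z c))"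
    and separation: "\<forall>\<phi> s. modal_free \<phi> \<and> set_fm \<phi> = {} \<longrightarrow>
      (\<forall>a. \<exists>b. \<forall>x. E x b \<longleftrightarrow> E x a \<and> sat E UNIV (s(0 := x)) \<phi>)"
    and replacement: "\<forall>\<phi> s. modal_free \<phi> \<and> set_fm \<phi> = {} \<longrightarrow>
      (\<forall>a. (\<forall>x. E x a \<longrightarrow> (\<exists>!y. sat E UNIV (s(0 := x, 1 := y)) \<phi>)) \<longrightarrow>
        (\<exists>b. \<forall>y. E y b \<longleftrightarrow> (\<exists>x. E x a \<and> sat E UNIV (s(0 := x, 1 := y)) \<phi>)))"

end

theory Submission
  imports Defs
begin

text \<open>
  Transitive sets under inclusion form a directed partial order, whence S4.2 is valid. For the
  upper bounds, a formula outside S5 or S4.2 fails at a node \<open>r\<close> of a finite frame (a cluster, or a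
  preorder with a top cluster), and we pull this failure back along a p-morphism from the
  transitive sets to the frame whose fibres are defined by sentences of \<open>\<L>\<^sub>\<in>\<close>.

  The \<^emph>\<open>dial\<close> of a world \<open>U\<close> is the number of times a set of the form \<open>x \<union> {x}\<close> can be peeled off it;
  passing to \<open>U \<union> {U, {U}}\<close> for nonempty \<open>U\<close> resets it to \<open>0\<close>, and successors then raise it to any
  value. The \<open>i\<close>-th \<^emph>\<open>button\<close> is an element \<open>{{y}}\<close> where \<open>y\<close> has dial exactly \<open>i + 1\<close>, for instance
  the numeral \<open>i + 1\<close>. As \<open>{{y}}\<close> is neither transitive nor the singleton of a transitive set, turning
  the dial presses no button, and the buttons are independent of each other.

  Give each node of the frame a button and a dial position. A world whose pressed nodes together
  with \<open>r\<close> form a chain is sent to the cluster of the greatest of them, any other world to the top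
  cluster; the dial selects the node inside the cluster. At the empty world no button is pressed,
  so it validates only S4.2. At an arbitrary world the dial alone handles a single cluster.
\<close>

section \<open>Finite Kripke models and canonical completeness\<close>

primrec ksat :: "'w set \<Rightarrow> ('w \<Rightarrow> 'w \<Rightarrow> bool) \<Rightarrow> (nat \<Rightarrow> 'w \<Rightarrow> bool) \<Rightarrow> 'w \<Rightarrow> pm \<Rightarrow> bool" where
  "ksat X R V x (PVar n) \<longleftrightarrow> V n x"
| "ksat X R V x PFls \<longleftrightarrow> False"
| "ksat X R V x (PImp p q) \<longleftrightarrow> (ksat X R V x p \<longrightarrow> ksat X R V x q)"
| "ksat X R V x (PBox p) \<longleftrightarrow> (\<forall>y\<in>X. R x y \<longrightarrow> ksat X R V y p)"

text \<open>Necessitation is available only inside \<open>logic\<close>, never for hypotheses; this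
  is what makes the deduction theorem hold.\<close>

inductive derives :: "pm set \<Rightarrow> pm set \<Rightarrow> pm \<Rightarrow> bool" for Ax S where
  hyp: "p \<in> S \<Longrightarrow> derives Ax S p"
| logic: "p \<in> normal_logic Ax \<Longrightarrow> derives Ax S p"
| mp: "derives Ax S (PImp p q) \<Longrightarrow> derives Ax S p \<Longrightarrow> derives Ax S q"

lemma derives_taut: "taut p \<Longrightarrow> derives Ax S p"
  by (simp add: derives.logic normal_logic.taut)

lemma derives_mono: "derives Ax S p \<Longrightarrow> S \<subseteq> T \<Longrightarrow> derives Ax T p"
  by (induction rule: derives.induct) (auto intro: derives.intros)

lemma derives_empty: "derives Ax {} p \<Longrightarrow> p \<in> normal_logic Ax"
  by (induction rule: derives.induct) (auto intro: normal_logic.mp)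

lemma derives_const: "derives Ax S q \<Longrightarrow> derives Ax S (PImp p q)"
  by (rule derives.mp[OF derives_taut]) (auto simp: taut_def)

lemma derives_imp_trans:
  assumes "derives Ax S (PImp r (PImp p q))" "derives Ax S (PImp r p)"
  shows "derives Ax S (PImp r q)"
proof -
  have "taut (PImp (PImp r (PImp p q)) (PImp (PImp r p) (PImp r q)))"
    by (auto simp: taut_def)
  then show ?thesis
    using assms by (meson derives.mp derives_taut)
qed

lemma deduction:
  assumes "derives Ax (insert p S) q"
  shows "derives Ax S (PImp p q)"
  using assms
proof induction
  case (hyp q)
  show ?case
  proof (cases "q = p")
    case True
    then show ?thesis by (auto intro: derives_taut simp: taut_def)
  next
    case False
    then show ?thesis using hyp by (auto intro: derives_const derives.hyp)
  qed
next
  case (logic q)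
  then show ?case by (auto intro: derives_const derives.logic)
next
  case (mp q q')
  then show ?case by (blast intro: derives_imp_trans)
qed

text \<open>A derivation uses finitely many hypotheses, so some member of the chain contains them
  all.\<close>

lemma derives_Union_chain:
  assumes "derives Ax (\<Union>C) p" "C \<noteq> {}" "\<And>S T. S \<in> C \<Longrightarrow> T \<in> C \<Longrightarrow> S \<subseteq> T \<or> T \<subseteq> S"
  shows "\<exists>S\<in>C. derives Ax S p"
  using assms(1)
proof induction
  case (hyp p)
  then show ?case by (auto intro: derives.hyp)
next
  case (logic p)
  then show ?case using assms(2) by (auto intro: derives.logic)
next
  case (mp p q)
  then obtain S T where "S \<in> C" "T \<in> C" "derives Ax S (PImp p q)" "derives Ax T p"
    by blast
  with assms(3)[of S T] show ?case
    by (meson derives.mp derives_mono)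
qed

section \<open>Maximal consistent sets\<close>

definition mcs :: "pm set \<Rightarrow> pm set \<Rightarrow> bool" where
  "mcs Ax M \<longleftrightarrow> (\<forall>q. derives Ax M q \<longrightarrow> q \<in> M) \<and> PFls \<notin> M \<and> (\<forall>p. p \<in> M \<or> PNeg p \<in> M)"

text \<open>Zorn's lemma is applied to the sets that do not derive \<open>r\<close>, not to all
  consistent ones, so that the maximal set omits \<open>r\<close>. It is consistent because
  \<open>PFls\<close> would derive \<open>r\<close>.\<close>

lemma lindenbaum:
  assumes "\<not> derives Ax S r"
  obtains M where "mcs Ax M" "S \<subseteq> M" "r \<notin> M"
proof -
  let ?A = "{T. S \<subseteq> T \<and> \<not> derives Ax T r}"
  have "\<exists>M\<in>?A. \<forall>T\<in>?A. M \<subseteq> T \<longrightarrow> T = M"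
  proof (rule subset_Zorn_nonempty)
    show "?A \<noteq> {}" using assms by auto
    fix C assume C: "C \<noteq> {}" "subset.chain ?A C"
    then have "\<And>T. T \<in> C \<Longrightarrow> S \<subseteq> T \<and> \<not> derives Ax T r"
      "\<And>T T'. T \<in> C \<Longrightarrow> T' \<in> C \<Longrightarrow> T \<subseteq> T' \<or> T' \<subseteq> T"
      unfolding subset.chain_def by blast+
    then show "\<Union>C \<in> ?A" using C(1) derives_Union_chain[of Ax C r] by blast
  qed
  then obtain M where M0: "M \<in> ?A" "\<forall>T\<in>?A. M \<subseteq> T \<longrightarrow> T = M" by (rule bexE)
  then have M: "S \<subseteq> M" "\<not> derives Ax M r"
    and max: "\<And>T. S \<subseteq> T \<Longrightarrow> \<not> derives Ax T r \<Longrightarrow> M \<subseteq> T \<Longrightarrow> T = M"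
    by simp_all
  have out: "derives Ax M (PImp p r)" if "p \<notin> M" for p
    using max[of "insert p M"] M(1) that by (blast intro: deduction)
  have closed: "q \<in> M" if "derives Ax M q" for q
    using out[of q] that M(2) derives.mp by blast
  have "PFls \<notin> M"
  proof
    assume "PFls \<in> M"
    moreover have "derives Ax M (PImp PFls r)" by (rule derives_taut) (simp add: taut_def)
    ultimately show False using M(2) by (blast intro: derives.intros)
  qed
  moreover have "p \<in> M \<or> PNeg p \<in> M" for p
  proof (rule ccontr)
    assume "\<not> (p \<in> M \<or> PNeg p \<in> M)"
    then have "derives Ax M (PImp p r)" "derives Ax M (PImp (PNeg p) r)"
      using out by auto
    moreover have "derives Ax M (PImp (PImp p r) (PImp (PImp (PNeg p) r) r))"
      by (rule derives_taut) (auto simp: taut_def)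
    ultimately show False using M(2) by (blast intro: derives.mp)
  qed
  moreover have "r \<notin> M" using M(2) derives.hyp by blast
  ultimately show ?thesis using that M(1) closed unfolding mcs_def by blast
qed

lemma mcs_closed: "mcs Ax M \<Longrightarrow> derives Ax M q \<Longrightarrow> q \<in> M"
  by (simp add: mcs_def)

lemma mcs_thm: "mcs Ax M \<Longrightarrow> q \<in> normal_logic Ax \<Longrightarrow> q \<in> M"
  by (simp add: mcs_closed derives.logic)

lemma mcs_PFls: "mcs Ax M \<Longrightarrow> PFls \<notin> M"
  by (simp add: mcs_def)

lemma mcs_PImp:
  assumes "mcs Ax M"
  shows "PImp p q \<in> M \<longleftrightarrow> (p \<in> M \<longrightarrow> q \<in> M)"
proof
  assume "PImp p q \<in> M"
  then show "p \<in> M \<longrightarrow> q \<in> M"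
    using assms by (meson derives.hyp derives.mp mcs_closed)
next
  assume *: "p \<in> M \<longrightarrow> q \<in> M"
  show "PImp p q \<in> M"
  proof (cases "p \<in> M")
    case True
    then show ?thesis using * assms by (meson derives.hyp derives_const mcs_closed)
  next
    case False
    then have "PNeg p \<in> M" using assms by (auto simp: mcs_def)
    moreover have "derives Ax M (PImp (PNeg p) (PImp p q))"
      by (rule derives_taut) (auto simp: taut_def)
    ultimately show ?thesis using assms by (meson derives.hyp derives.mp mcs_closed)
  qed
qed

section \<open>The canonical accessibility relation\<close>

definition unbox :: "pm set \<Rightarrow> pm set" where
  "unbox M = {q. PBox q \<in> M}"

text \<open>Theorems are absorbed by necessitation and modus ponens by K, so finite conjunctions of
  hypotheses never have to be formed.\<close>

lemma derives_unbox:
  assumes "derives Ax (unbox M) p" "mcs Ax M"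
  shows "p \<in> unbox M"
  using assms(1)
proof induction
  case (hyp p)
  then show ?case .
next
  case (logic p)
  then show ?case using assms(2) by (auto simp: unbox_def intro: mcs_thm normal_logic.nec)
next
  case (mp p q)
  have "PImp (PBox (PImp p q)) (PImp (PBox p) (PBox q)) \<in> M"
    using assms(2) by (blast intro: mcs_thm normal_logic.K)
  with mp show ?case using assms(2) by (auto simp: unbox_def mcs_PImp)
qed

lemma mcs_PBox:
  assumes "mcs Ax M"
  shows "PBox p \<in> M \<longleftrightarrow> (\<forall>N. mcs Ax N \<and> unbox M \<subseteq> N \<longrightarrow> p \<in> N)"
proof
  assume "PBox p \<in> M"
  then show "\<forall>N. mcs Ax N \<and> unbox M \<subseteq> N \<longrightarrow> p \<in> N" by (auto simp: unbox_def)
next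
  assume *: "\<forall>N. mcs Ax N \<and> unbox M \<subseteq> N \<longrightarrow> p \<in> N"
  have "derives Ax (unbox M) p"
    using * lindenbaum by metis
  then show "PBox p \<in> M" using derives_unbox[OF _ assms] by (simp add: unbox_def)
qed

lemma mcs_PDia_intro:
  assumes "mcs Ax M" "mcs Ax N" "unbox M \<subseteq> N" "p \<in> N"
  shows "PDia p \<in> M"
proof -
  have "PNeg p \<notin> N" using assms by (auto simp: mcs_PImp mcs_PFls)
  then have "PBox (PNeg p) \<notin> M" using assms(3) by (auto simp: unbox_def)
  then show ?thesis by (simp add: mcs_PImp[OF assms(1)])
qed

lemma unbox_refl:
  assumes "axT \<subseteq> Ax" "mcs Ax M"
  shows "unbox M \<subseteq> M"
proof
  fix p assume "p \<in> unbox M"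
  moreover have "PImp (PBox p) p \<in> M"
    using assms by (intro mcs_thm[OF assms(2)] normal_logic.ax) (auto simp: axT_def)
  ultimately show "p \<in> M" by (simp add: unbox_def mcs_PImp[OF assms(2)])
qed

lemma unbox_unbox:
  assumes "ax4 \<subseteq> Ax" "mcs Ax M" "p \<in> unbox M"
  shows "PBox p \<in> unbox M"
proof -
  have "PImp (PBox p) (PBox (PBox p)) \<in> M"
    using assms(1) by (intro mcs_thm[OF assms(2)] normal_logic.ax) (auto simp: ax4_def)
  then show ?thesis using assms(3) by (simp add: unbox_def mcs_PImp[OF assms(2)])
qed

text \<open>The hypotheses taken from \<open>unbox N\<close> can be gathered into a single
  \<open>b\<close>, because \<open>unbox N\<close> is closed under conjunction.\<close>

lemma derives_Un_interpolant:
  assumes "derives Ax (unbox M \<union> unbox N) q" "mcs Ax M" "mcs Ax N"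
  shows "\<exists>b \<in> unbox N. PImp b q \<in> unbox M"
proof -
  have top: "PImp PFls PFls \<in> unbox N"
    by (rule derives_unbox[OF derives_taut assms(3)]) (simp add: taut_def)
  show ?thesis
    using assms(1)
  proof induction
    case (hyp q)
    show ?case
    proof (cases "q \<in> unbox M")
      case True
      then show ?thesis
        using top assms(2) by (meson derives.hyp derives_const derives_unbox)
    next
      case False
      moreover have "PImp q q \<in> unbox M"
        by (rule derives_unbox[OF derives_taut assms(2)]) (simp add: taut_def)
      ultimately show ?thesis using hyp by blast
    qed
  next
    case (logic q)
    then show ?case
      using top assms(2) by (meson derives.logic derives_const derives_unbox)
  next
    case (mp p q)
    then obtain b c where bc: "b \<in> unbox N" "c \<in> unbox N"
      "PImp b (PImp p q) \<in> unbox M" "PImp c p \<in> unbox M" by blast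
    \<comment> \<open>The conjunction of \<open>b\<close> and \<open>c\<close>, written with the
      primitive connectives.\<close>
    let ?d = "PNeg (PImp b (PNeg c))"
    have "derives Ax (unbox N) (PImp b (PImp c ?d))"
      by (rule derives_taut) (auto simp: taut_def)
    then have "?d \<in> unbox N"
      using bc assms(3) by (meson derives.hyp derives.mp derives_unbox)
    moreover have "derives Ax (unbox M)
        (PImp (PImp b (PImp p q)) (PImp (PImp c p) (PImp ?d q)))"
      by (rule derives_taut) (auto simp: taut_def)
    then have "PImp ?d q \<in> unbox M"
      using bc assms(2) by (meson derives.hyp derives.mp derives_unbox)
    ultimately show ?case by blast
  qed
qed

text \<open>If the two sets of unboxed formulas clash, some \<open>b\<close> is boxed in
  \<open>N2\<close> and its negation is boxed in \<open>N1\<close>. Then \<open>M\<close> contains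
  \<open>PDia (PBox b)\<close>, hence \<open>PBox (PDia b)\<close>, which puts \<open>PDia b\<close>
  into \<open>N1\<close>.\<close>

lemma canonical_directed:
  assumes Ax: "ax2 \<subseteq> Ax"
    and M: "mcs Ax M" "mcs Ax N1" "mcs Ax N2" "unbox M \<subseteq> N1" "unbox M \<subseteq> N2"
  obtains N where "mcs Ax N" "unbox N1 \<subseteq> N" "unbox N2 \<subseteq> N"
proof -
  have "\<not> derives Ax (unbox N1 \<union> unbox N2) PFls"
  proof
    assume "derives Ax (unbox N1 \<union> unbox N2) PFls"
    then obtain b where b: "b \<in> unbox N2" "PNeg b \<in> unbox N1"
      using derives_Un_interpolant M by blast
    have "PDia (PBox b) \<in> M"
      using b(1) M by (intro mcs_PDia_intro[of Ax M N2]) (auto simp: unbox_def)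
    moreover have "PImp (PDia (PBox b)) (PBox (PDia b)) \<in> M"
      using Ax by (intro mcs_thm[OF M(1)] normal_logic.ax) (auto simp: ax2_def)
    ultimately have "PBox (PDia b) \<in> M"
      using mcs_PImp[OF M(1)] by blast
    then have "PDia b \<in> N1" using M(4) by (auto simp: unbox_def)
    then show False using b(2) mcs_PFls[OF M(2)] by (simp add: mcs_PImp[OF M(2)] unbox_def)
  qed
  then obtain N where "mcs Ax N" "unbox N1 \<union> unbox N2 \<subseteq> N" by (rule lindenbaum)
  then show ?thesis using that by simp
qed

text \<open>A formula boxed in \<open>N1\<close> but absent from \<open>N2\<close> makes its
  negation possible at \<open>M\<close>, hence by axiom 5 possible at \<open>N1\<close> as well, a
  contradiction.\<close>

lemma canonical_euclidean:
  assumes Ax: "ax5 \<subseteq> Ax"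
    and M: "mcs Ax M" "mcs Ax N1" "mcs Ax N2" "unbox M \<subseteq> N1" "unbox M \<subseteq> N2"
  shows "unbox N1 \<subseteq> N2"
proof
  fix q assume q: "q \<in> unbox N1"
  show "q \<in> N2"
  proof (rule ccontr)
    assume "q \<notin> N2"
    then have "PNeg q \<in> N2" using mcs_PImp[OF M(3)] by blast
    then have "PDia (PNeg q) \<in> M" using M by (blast intro: mcs_PDia_intro)
    moreover have "PImp (PDia (PNeg q)) (PBox (PDia (PNeg q))) \<in> M"
      using Ax by (intro mcs_thm[OF M(1)] normal_logic.ax) (auto simp: ax5_def)
    ultimately have "PBox (PDia (PNeg q)) \<in> M"
      using mcs_PImp[OF M(1)] by blast
    then have "PDia (PNeg q) \<in> N1" using M(4) by (auto simp: unbox_def)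
    then have "PBox (PNeg (PNeg q)) \<notin> N1"
      using mcs_PFls[OF M(2)] by (auto simp: mcs_PImp[OF M(2)])
    moreover have "PNeg (PNeg q) \<in> unbox N1"
    proof -
      have "derives Ax (unbox N1) (PImp q (PNeg (PNeg q)))"
        by (rule derives_taut) (auto simp: taut_def)
      then show ?thesis using q M(2) by (meson derives.hyp derives.mp derives_unbox)
    qed
    ultimately show False by (simp add: unbox_def)
  qed
qed

section \<open>Finite filtrations of the canonical model\<close>

primrec subfms :: "pm \<Rightarrow> pm set" where
  "subfms (PVar n) = {PVar n}"
| "subfms PFls = {PFls}"
| "subfms (PImp p q) = insert (PImp p q) (subfms p \<union> subfms q)"
| "subfms (PBox p) = insert (PBox p) (subfms p)"

lemma finite_subfms: "finite (subfms p)"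
  by (induction p) auto

lemma subfms_self: "p \<in> subfms p"
  by (cases p) auto

lemma subfms_trans: "q \<in> subfms p \<Longrightarrow> subfms q \<subseteq> subfms p"
  by (induction p) auto

text \<open>Only sets accessible from \<open>M\<close> are used: they share the predecessor
  \<open>M\<close>, which the frame conditions of .2 and 5 need.\<close>

definition filtration :: "pm set \<Rightarrow> pm \<Rightarrow> pm set \<Rightarrow> pm set set" where
  "filtration Ax p M = {N \<inter> subfms p | N. mcs Ax N \<and> unbox M \<subseteq> N}"

text \<open>The Lemmon filtration: passing on the boxed formula together with its body makes the
  relation transitive outright.\<close>

definition filt_rel :: "pm set \<Rightarrow> pm set \<Rightarrow> bool" where
  "filt_rel S T \<longleftrightarrow> (\<forall>q. PBox q \<in> S \<longrightarrow> q \<in> T \<and> PBox q \<in> T)"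

lemma finite_filtration: "finite (filtration Ax p M)"
  by (rule finite_subset[of _ "Pow (subfms p)"]) (auto simp: filtration_def finite_subfms)

lemma filt_rel_canonical:
  assumes "ax4 \<subseteq> Ax" "mcs Ax M" "unbox M \<subseteq> N"
  shows "filt_rel (M \<inter> subfms p) (N \<inter> subfms p)"
  unfolding filt_rel_def
proof (intro allI impI)
  fix q assume q: "PBox q \<in> M \<inter> subfms p"
  then have "q \<in> unbox M" by (simp add: unbox_def)
  then have "q \<in> N" "PBox q \<in> N" using unbox_unbox[OF assms(1,2)] assms(3) by auto
  moreover have "q \<in> subfms p" using q subfms_trans[of "PBox q" p] subfms_self[of q] by auto
  ultimately show "q \<in> N \<inter> subfms p \<and> PBox q \<in> N \<inter> subfms p" using q by auto
qed

lemma filtration_truth: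
  assumes Ax: "axT \<subseteq> Ax" "ax4 \<subseteq> Ax" and M: "mcs Ax M"
  shows "q \<in> subfms p \<Longrightarrow> mcs Ax N \<Longrightarrow> unbox M \<subseteq> N \<Longrightarrow>
    ksat (filtration Ax p M) filt_rel (\<lambda>n S. PVar n \<in> S) (N \<inter> subfms p) q \<longleftrightarrow> q \<in> N"
proof (induction q arbitrary: N)
  case (PVar n)
  then show ?case by simp
next
  case PFls
  then show ?case by (simp add: mcs_PFls)
next
  case (PImp a b)
  have "a \<in> subfms p" "b \<in> subfms p"
    using subfms_trans[OF PImp.prems(1)] subfms_self by auto
  with PImp show ?case by (simp add: mcs_PImp)
next
  case (PBox a)
  have a: "a \<in> subfms p"
    using subfms_trans[OF PBox.prems(1)] subfms_self by auto
  \<comment> \<open>By axiom 4, canonical successors of \<open>N\<close> are still accessible from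
    \<open>M\<close>, so the induction hypothesis applies to them.\<close>
  have step: "unbox M \<subseteq> N'" if "unbox N \<subseteq> N'" for N'
    using unbox_unbox[OF Ax(2) M] PBox.prems(3) that by (auto simp: unbox_def)
  show ?case
  proof
    assume L: "ksat (filtration Ax p M) filt_rel (\<lambda>n S. PVar n \<in> S) (N \<inter> subfms p) (PBox a)"
    have "a \<in> N'" if N': "mcs Ax N'" "unbox N \<subseteq> N'" for N'
    proof -
      have "N' \<inter> subfms p \<in> filtration Ax p M"
        using N' step by (auto simp: filtration_def)
      moreover have "filt_rel (N \<inter> subfms p) (N' \<inter> subfms p)"
        using filt_rel_canonical[OF Ax(2) PBox.prems(2) N'(2)] .
      ultimately show ?thesis using L PBox.IH[OF a N'(1) step[OF N'(2)]] by auto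
    qed
    then show "PBox a \<in> N" using mcs_PBox[OF PBox.prems(2)] by blast
  next
    assume Na: "PBox a \<in> N"
    have "ksat (filtration Ax p M) filt_rel (\<lambda>n S. PVar n \<in> S) y a"
      if y: "y \<in> filtration Ax p M" "filt_rel (N \<inter> subfms p) y" for y
    proof -
      obtain N' where N': "mcs Ax N'" "unbox M \<subseteq> N'" "y = N' \<inter> subfms p"
        using y(1) unfolding filtration_def by blast
      have "a \<in> N'" using y(2) Na PBox.prems(1) N'(3) by (auto simp: filt_rel_def)
      then show ?thesis using PBox.IH[OF a N'(1,2)] N'(3) by simp
    qed
    then show "ksat (filtration Ax p M) filt_rel (\<lambda>n S. PVar n \<in> S) (N \<inter> subfms p) (PBox a)"
      by simp
  qed
qed

lemma finite_directed_upper_bound: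
  assumes "finite Y" "Y \<subseteq> X" "x0 \<in> X"
    and "\<And>x y z. R x y \<Longrightarrow> R y z \<Longrightarrow> R x z"
    and "\<And>x y. x \<in> X \<Longrightarrow> y \<in> X \<Longrightarrow> \<exists>z\<in>X. R x z \<and> R y z"
  shows "\<exists>t\<in>X. \<forall>y\<in>Y. R y t"
  using assms(1,2)
proof (induction Y)
  case empty
  then show ?case using assms(3) by auto
next
  case (insert y Y)
  then obtain t where t: "t \<in> X" "\<forall>y\<in>Y. R y t" by auto
  then obtain z where "z \<in> X" "R t z" "R y z" using assms(5)[of t y] insert.prems by auto
  then show ?case using t(2) assms(4) by blast
qed

lemma filtration_countermodel:
  assumes "axT \<subseteq> Ax" "ax4 \<subseteq> Ax" "p \<notin> normal_logic Ax"
  obtains M where "mcs Ax M" "M \<inter> subfms p \<in> filtration Ax p M"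
    "\<not> ksat (filtration Ax p M) filt_rel (\<lambda>n S. PVar n \<in> S) (M \<inter> subfms p) p"
proof -
  obtain M where M: "mcs Ax M" "p \<notin> M"
    using lindenbaum derives_empty assms(3) by metis
  have MM: "unbox M \<subseteq> M" using unbox_refl[OF assms(1) M(1)] .
  then have "M \<inter> subfms p \<in> filtration Ax p M" using M by (auto simp: filtration_def)
  moreover have "\<not> ksat (filtration Ax p M) filt_rel (\<lambda>n S. PVar n \<in> S) (M \<inter> subfms p) p"
    using filtration_truth[OF assms(1,2) M(1) subfms_self M(1) MM] M(2) by blast
  ultimately show ?thesis using that M(1) by blast
qed

lemma filt_rel_refl:
  assumes "axT \<subseteq> Ax" "ax4 \<subseteq> Ax" "x \<in> filtration Ax p M"
  shows "filt_rel x x"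
proof -
  obtain N where N: "mcs Ax N" "x = N \<inter> subfms p" using assms(3) by (auto simp: filtration_def)
  show ?thesis
    using filt_rel_canonical[OF assms(2) N(1) unbox_refl[OF assms(1) N(1)]] N(2) by simp
qed

lemma filt_rel_trans: "filt_rel x y \<Longrightarrow> filt_rel y z \<Longrightarrow> filt_rel x z"
  by (auto simp: filt_rel_def)

text \<open>Any two nodes have representatives accessible from \<open>M\<close>, which directedness
  joins; since the model is finite, this yields a top node \<open>t\<close>.\<close>

lemma S42_countermodel:
  assumes "p \<notin> S42"
  obtains X :: "pm set set" and r t R V where "finite X" "r \<in> X" "t \<in> X"
    "\<forall>x\<in>X. R x x" "\<forall>x y z. R x y \<longrightarrow> R y z \<longrightarrow> R x z"
    "\<forall>x\<in>X. R x t" "\<not> ksat X R V r p"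
proof -
  let ?Ax = "axT \<union> ax4 \<union> ax2"
  have Ax: "axT \<subseteq> ?Ax" "ax4 \<subseteq> ?Ax" "ax2 \<subseteq> ?Ax" by auto
  obtain M where M: "mcs ?Ax M" "M \<inter> subfms p \<in> filtration ?Ax p M"
    "\<not> ksat (filtration ?Ax p M) filt_rel (\<lambda>n S. PVar n \<in> S) (M \<inter> subfms p) p"
    using filtration_countermodel[OF Ax(1,2)] assms unfolding S42_def by metis
  let ?X = "filtration ?Ax p M"
  have dir: "\<exists>z\<in>?X. filt_rel x z \<and> filt_rel y z" if xy: "x \<in> ?X" "y \<in> ?X" for x y
  proof -
    obtain N1 N2 where N: "mcs ?Ax N1" "mcs ?Ax N2" "unbox M \<subseteq> N1" "unbox M \<subseteq> N2"
      "x = N1 \<inter> subfms p" "y = N2 \<inter> subfms p"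
      using xy unfolding filtration_def by blast
    obtain N where N': "mcs ?Ax N" "unbox N1 \<subseteq> N" "unbox N2 \<subseteq> N"
      using canonical_directed[OF Ax(3) M(1) N(1-4)] .
    have "unbox M \<subseteq> N"
      using unbox_unbox[OF Ax(2) M(1)] N(3) N'(2) by (auto simp: unbox_def)
    then have "N \<inter> subfms p \<in> ?X" using N'(1) by (auto simp: filtration_def)
    then show ?thesis
      using filt_rel_canonical[OF Ax(2)] N N' by blast
  qed
  have "\<exists>t\<in>?X. \<forall>x\<in>?X. filt_rel x t"
    by (rule finite_directed_upper_bound[OF finite_filtration order_refl M(2)])
      (blast intro: filt_rel_trans dir)+
  then obtain t where t: "t \<in> ?X" "\<And>x. x \<in> ?X \<Longrightarrow> filt_rel x t" by blast
  show ?thesis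
    by (rule that[OF finite_filtration M(2) t(1) _ _ _ M(3)])
      (blast intro: filt_rel_refl[OF Ax(1,2)] filt_rel_trans t(2))+
qed

text \<open>All nodes have representatives accessible from \<open>M\<close>, so the euclidean
  property merges them into a single cluster.\<close>

lemma S5_countermodel:
  assumes "p \<notin> S5"
  obtains X :: "pm set set" and r R V where "finite X" "r \<in> X"
    "\<forall>x\<in>X. \<forall>y\<in>X. R x y" "\<not> ksat X R V r p"
proof -
  let ?Ax = "axT \<union> ax4 \<union> ax5"
  have Ax: "axT \<subseteq> ?Ax" "ax4 \<subseteq> ?Ax" "ax5 \<subseteq> ?Ax" by auto
  obtain M where M: "mcs ?Ax M" "M \<inter> subfms p \<in> filtration ?Ax p M"
    "\<not> ksat (filtration ?Ax p M) filt_rel (\<lambda>n S. PVar n \<in> S) (M \<inter> subfms p) p"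
    using filtration_countermodel[OF Ax(1,2)] assms unfolding S5_def by metis
  let ?X = "filtration ?Ax p M"
  have cluster: "filt_rel x y" if xy: "x \<in> ?X" "y \<in> ?X" for x y
  proof -
    obtain N1 N2 where N: "mcs ?Ax N1" "mcs ?Ax N2" "unbox M \<subseteq> N1" "unbox M \<subseteq> N2"
      "x = N1 \<inter> subfms p" "y = N2 \<inter> subfms p"
      using xy unfolding filtration_def by blast
    then show ?thesis
      using filt_rel_canonical[OF Ax(2) N(1) canonical_euclidean[OF Ax(3) M(1) N(1-4)]] by simp
  qed
  show ?thesis
    by (rule that[OF finite_filtration M(2) _ M(3)]) (blast intro: cluster)
qed

section \<open>Pulling back along p-morphisms\<close>

text \<open>Here \<open>l\<close> is a bounded morphism on the cone of worlds above
  \<open>W\<close>, and \<open>\<sigma>\<close> defines the valuation pulled back along it. In the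
  box case, \<open>zag\<close> carries truth from the worlds to the frame and \<open>zig\<close>
  carries it back.\<close>

lemma sat_p_morphism:
  assumes in_X: "\<And>U. trans_set E U \<Longrightarrow> ext E W \<subseteq> ext E U \<Longrightarrow> l U \<in> X"
    and zig: "\<And>U U'. trans_set E U \<Longrightarrow> trans_set E U' \<Longrightarrow> ext E W \<subseteq> ext E U \<Longrightarrow>
      ext E U \<subseteq> ext E U' \<Longrightarrow> R (l U) (l U')"
    and zag: "\<And>U y. trans_set E U \<Longrightarrow> ext E W \<subseteq> ext E U \<Longrightarrow> y \<in> X \<Longrightarrow> R (l U) y \<Longrightarrow>
      \<exists>U'. trans_set E U' \<and> ext E U \<subseteq> ext E U' \<and> l U' = y"
    and val: "\<And>n U s. trans_set E U \<Longrightarrow> sat E (ext E U) s (\<sigma> n) \<longleftrightarrow> V n (l U)"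
  shows "trans_set E U \<Longrightarrow> ext E W \<subseteq> ext E U \<Longrightarrow>
    sat E (ext E U) s (inst \<sigma> p) \<longleftrightarrow> ksat X R V (l U) p"
proof (induction p arbitrary: U)
  case (PBox p)
  have "sat E (ext E U) s (inst \<sigma> (PBox p)) \<longleftrightarrow>
      (\<forall>U'. trans_set E U' \<and> ext E U \<subseteq> ext E U' \<longrightarrow> ksat X R V (l U') p)"
    using PBox.IH PBox.prems(2) by (auto intro: order_trans)
  also have "\<dots> \<longleftrightarrow> ksat X R V (l U) (PBox p)"
  proof
    assume *: "\<forall>U'. trans_set E U' \<and> ext E U \<subseteq> ext E U' \<longrightarrow> ksat X R V (l U') p"
    show "ksat X R V (l U) (PBox p)"
      using zag[OF PBox.prems] * by fastforce
  next
    assume "ksat X R V (l U) (PBox p)"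
    then show "\<forall>U'. trans_set E U' \<and> ext E U \<subseteq> ext E U' \<longrightarrow> ksat X R V (l U') p"
      using zig[OF PBox.prems(1) _ PBox.prems(2)] in_X PBox.prems(2) by (simp add: subset_trans)
  qed
  finally show ?case .
qed (auto simp: val)

lemma peval_inst: "peval (\<lambda>q. sat E D s (inst \<sigma> q)) p \<longleftrightarrow> sat E D s (inst \<sigma> p)"
  by (induction p) auto

section \<open>Sets in a model of ZFC\<close>

context ZFC
begin

lemma ex_adjoin: "\<exists>z. \<forall>w. E w z \<longleftrightarrow> E w x \<or> w = y"
proof -
  obtain a where a: "\<And>z. E z a \<longleftrightarrow> z = y" using pairing by metis
  obtain b where b: "\<And>z. E z b \<longleftrightarrow> z = x \<or> z = a" using pairing by metis
  obtain u where "\<And>z. E z u \<longleftrightarrow> (\<exists>v. E v b \<and> E z v)" using union by metis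
  with a b show ?thesis by metis
qed

text \<open>Extensions of worlds are built by adjoining one element at a time, so that transitivity
  and newly pressed buttons are checked element by element.\<close>

definition adj :: "'v \<Rightarrow> 'v \<Rightarrow> 'v" where
  "adj x y = (SOME z. \<forall>w. E w z \<longleftrightarrow> E w x \<or> w = y)"

lemma mem_adj [simp]: "E w (adj x y) \<longleftrightarrow> E w x \<or> w = y"
  using someI_ex[OF ex_adjoin[of x y]] unfolding adj_def by blast

definition emp :: 'v where
  "emp = (SOME e. \<forall>z. \<not> E z e)"

lemma mem_emp [simp]: "\<not> E z emp"
proof -
  have "\<exists>e. \<forall>z. \<not> E z e" using infinity by blast
  from someI_ex[OF this] show ?thesis unfolding emp_def by blast
qed

definition sing :: "'v \<Rightarrow> 'v" where
  "sing x = adj emp x"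

lemma mem_sing [simp]: "E w (sing x) \<longleftrightarrow> w = x"
  by (simp add: sing_def)

lemma set_eqI: "(\<And>z. E z x \<longleftrightarrow> E z y) \<Longrightarrow> x = y"
  using extensionality by blast

lemma mem_asym: "E x y \<Longrightarrow> \<not> E y x"
  using foundation[rule_format, of "adj (sing x) y"] by auto

lemma mem_irrefl: "\<not> E x x"
  using mem_asym by blast

definition succ :: "'v \<Rightarrow> 'v" where
  "succ x = adj x x"

lemma mem_succ [simp]: "E w (succ x) \<longleftrightarrow> E w x \<or> w = x"
  by (simp add: succ_def)

lemma succ_inject: "succ x = succ y \<Longrightarrow> x = y"
  using mem_asym mem_succ by metis

lemma trans_adj: "trans_set E U \<Longrightarrow> (\<And>z. E z y \<Longrightarrow> E z U) \<Longrightarrow> trans_set E (adj U y)"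
  unfolding trans_set_def by auto

lemma trans_emp: "trans_set E emp"
  by (simp add: trans_set_def)

lemma trans_succ: "trans_set E U \<Longrightarrow> trans_set E (succ U)"
  by (simp add: succ_def trans_adj)

lemma ext_adj: "ext E U \<subseteq> ext E (adj U y)"
  by (auto simp: ext_def)

lemma ext_succ: "ext E U \<subseteq> ext E (succ U)"
  by (auto simp: ext_def)

lemma ex_trans_union:
  assumes "trans_set E U" "trans_set E U'"
  shows "\<exists>Y. trans_set E Y \<and> ext E U \<subseteq> ext E Y \<and> ext E U' \<subseteq> ext E Y"
proof -
  obtain Y where "\<And>z. E z Y \<longleftrightarrow> (\<exists>y. E y (adj (sing U) U') \<and> E z y)"
    using union by metis
  then have "\<And>z. E z Y \<longleftrightarrow> E z U \<or> E z U'" by auto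
  then show ?thesis using assms unfolding trans_set_def ext_def by blast
qed

text \<open>Nothing is assumed about \<open>\<sigma>\<close>, so modal operators and parameters are
  covered. The world varies in the induction for the sake of necessitation; .2 holds because the
  union of two transitive sets is transitive.\<close>

lemma S42_sound:
  assumes "p \<in> S42"
  shows "trans_set E U \<Longrightarrow> sat E (ext E U) s (inst \<sigma> p)"
  using assms unfolding S42_def
proof (induction p arbitrary: U)
  case (taut p)
  then show ?case by (metis peval_inst taut_def)
next
  case (ax p)
  then consider (T) q where "p = PImp (PBox q) q"
    | (4) q where "p = PImp (PBox q) (PBox (PBox q))"
    | (2) q where "p = PImp (PDia (PBox q)) (PBox (PDia q))"
    by (auto simp: axT_def ax4_def ax2_def)
  then show ?case
  proof cases
    case T
    then show ?thesis using ax.prems by auto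
  next
    case 4
    then show ?thesis by simp (meson subset_trans)
  next
    case 2
    have "\<exists>Y. trans_set E Y \<and> ext E U2 \<subseteq> ext E Y \<and> sat E (ext E Y) s (inst \<sigma> q)"
      if "trans_set E U1" "trans_set E U2"
        and "\<forall>Y. trans_set E Y \<and> ext E U1 \<subseteq> ext E Y \<longrightarrow> sat E (ext E Y) s (inst \<sigma> q)" for U1 U2
      using that ex_trans_union by blast
    with 2 show ?thesis by simp blast
  qed
qed auto

section \<open>Definability in transitive sets\<close>

text \<open>One formula has to work uniformly in all transitive worlds. Closure under the logical
  operations then replaces writing formulas out.\<close>

definition definable :: "nat set \<Rightarrow> ('v \<Rightarrow> (nat \<Rightarrow> 'v) \<Rightarrow> bool) \<Rightarrow> bool" where
  "definable N P \<longleftrightarrow> (\<exists>\<phi> :: 'v fm. modal_free \<phi> \<and> set_fm \<phi> = {} \<and> fv \<phi> \<subseteq> N \<and>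
    (\<forall>U s. trans_set E U \<longrightarrow> (\<forall>i\<in>N. E (s i) U) \<longrightarrow> (sat E (ext E U) s \<phi> \<longleftrightarrow> P U s)))"

lemma definable_cong:
  assumes "definable N P"
    and "\<And>U s. trans_set E U \<Longrightarrow> \<forall>i\<in>N. E (s i) U \<Longrightarrow> P U s \<longleftrightarrow> Q U s"
  shows "definable N Q"
  using assms unfolding definable_def by meson

lemma definable_mono: "definable N P \<Longrightarrow> N \<subseteq> N' \<Longrightarrow> definable N' P"
  unfolding definable_def by (meson subset_iff)

lemma definable_Mem: "i \<in> N \<Longrightarrow> j \<in> N \<Longrightarrow> definable N (\<lambda>U s. E (s i) (s j))"
  unfolding definable_def by (rule exI[of _ "Mem (Var i) (Var j)"]) auto

lemma definable_Eq: "i \<in> N \<Longrightarrow> j \<in> N \<Longrightarrow> definable N (\<lambda>U s. s i = s j)"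
  unfolding definable_def by (rule exI[of _ "Eq (Var i) (Var j)"]) auto

lemma definable_False: "definable N (\<lambda>U s. False)"
  unfolding definable_def by (rule exI[of _ Fls]) auto

lemma definable_imp:
  assumes "definable N P" "definable N Q"
  shows "definable N (\<lambda>U s. P U s \<longrightarrow> Q U s)"
proof -
  obtain \<phi> \<psi> :: "'v fm" where
    "modal_free \<phi>" "set_fm \<phi> = {}" "fv \<phi> \<subseteq> N"
    "\<forall>U s. trans_set E U \<longrightarrow> (\<forall>i\<in>N. E (s i) U) \<longrightarrow> (sat E (ext E U) s \<phi> \<longleftrightarrow> P U s)"
    "modal_free \<psi>" "set_fm \<psi> = {}" "fv \<psi> \<subseteq> N"
    "\<forall>U s. trans_set E U \<longrightarrow> (\<forall>i\<in>N. E (s i) U) \<longrightarrow> (sat E (ext E U) s \<psi> \<longleftrightarrow> Q U s)"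
    using assms unfolding definable_def by metis
  then show ?thesis
    unfolding definable_def by (intro exI[of _ "Imp \<phi> \<psi>"]) simp
qed

lemma definable_all:
  assumes "definable (insert n N) P"
  shows "definable N (\<lambda>U s. \<forall>a. E a U \<longrightarrow> P U (s(n := a)))"
proof -
  obtain \<phi> :: "'v fm" where
    "modal_free \<phi>" "set_fm \<phi> = {}" "fv \<phi> \<subseteq> insert n N"
    "\<forall>U s. trans_set E U \<longrightarrow> (\<forall>i\<in>insert n N. E (s i) U) \<longrightarrow> (sat E (ext E U) s \<phi> \<longleftrightarrow> P U s)"
    using assms unfolding definable_def by metis
  then show ?thesis
    unfolding definable_def by (intro exI[of _ "All n \<phi>"]) (auto simp: ext_def)
qed

lemma definable_not: "definable N P \<Longrightarrow> definable N (\<lambda>U s. \<not> P U s)"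
  using definable_imp[OF _ definable_False] by simp

lemma definable_disj:
  "definable N P \<Longrightarrow> definable N Q \<Longrightarrow> definable N (\<lambda>U s. P U s \<or> Q U s)"
  using definable_imp[OF definable_not[of N P], of Q] by (simp add: disj_imp)

lemma definable_conj:
  "definable N P \<Longrightarrow> definable N Q \<Longrightarrow> definable N (\<lambda>U s. P U s \<and> Q U s)"
  using definable_not[OF definable_disj[OF definable_not definable_not], of N P Q] by simp

lemma definable_iff:
  "definable N P \<Longrightarrow> definable N Q \<Longrightarrow> definable N (\<lambda>U s. P U s \<longleftrightarrow> Q U s)"
  using definable_conj[OF definable_imp definable_imp, of N P Q Q P] by (simp add: iff_conv_conj_imp)

lemma definable_ex:
  "definable (insert n N) P \<Longrightarrow> definable N (\<lambda>U s. \<exists>a. E a U \<and> P U (s(n := a)))"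
  using definable_not[OF definable_all[OF definable_not], of n N P] by simp

lemma definable_const: "definable N (\<lambda>U s. c)"
  using definable_False[of N] definable_not[OF definable_False, of N] by (cases c) auto

lemma definable_bex:
  assumes "finite A" "\<And>x. x \<in> A \<Longrightarrow> definable N (P x)"
  shows "definable N (\<lambda>U s. \<exists>x\<in>A. P x U s)"
  using assms by (induction A) (simp_all add: definable_False definable_disj)

lemma definable_ball:
  assumes "finite A" "\<And>x. x \<in> A \<Longrightarrow> definable N (P x)"
  shows "definable N (\<lambda>U s. \<forall>x\<in>A. P x U s)"
  using definable_not[OF definable_bex[OF assms(1) definable_not[OF assms(2)]]] by simp

text \<open>The pair of subsets has finitely many possible values. A finite disjunction runs through
  them, and the arbitrary \<open>F\<close> enters only as a truth constant for each value.\<close>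

lemma definable_of_finite_info:
  assumes "finite X" "\<And>x. x \<in> X \<Longrightarrow> definable N (P x)" "\<And>x. x \<in> X \<Longrightarrow> definable N (Q x)"
  shows "definable N (\<lambda>U s. F {x\<in>X. P x U s} {x\<in>X. Q x U s})"
proof -
  have "definable N (\<lambda>U s. \<exists>a\<in>Pow X. \<exists>b\<in>Pow X. F a b \<and>
      (\<forall>x\<in>X. P x U s \<longleftrightarrow> x \<in> a) \<and> (\<forall>x\<in>X. Q x U s \<longleftrightarrow> x \<in> b))"
    by (intro definable_bex definable_conj definable_ball definable_iff definable_const)
      (use assms in auto)
  then show ?thesis
  proof (rule definable_cong)
    fix U s
    have "(\<forall>x\<in>X. P x U s \<longleftrightarrow> x \<in> a) \<longleftrightarrow> a = {x\<in>X. P x U s}"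
      "(\<forall>x\<in>X. Q x U s \<longleftrightarrow> x \<in> a) \<longleftrightarrow> a = {x\<in>X. Q x U s}" if "a \<in> Pow X" for a
      using that by auto
    then show "(\<exists>a\<in>Pow X. \<exists>b\<in>Pow X. F a b \<and>
      (\<forall>x\<in>X. P x U s \<longleftrightarrow> x \<in> a) \<and> (\<forall>x\<in>X. Q x U s \<longleftrightarrow> x \<in> b)) \<longleftrightarrow>
      F {x\<in>X. P x U s} {x\<in>X. Q x U s}"
      by (auto intro!: bexI[of _ "{x\<in>X. P x U s}"] bexI[of _ "{x\<in>X. Q x U s}"])
  qed
qed

lemma definable_sentence:
  assumes "definable {} (\<lambda>U s. P U)"
  shows "\<exists>\<phi> \<in> L_in. \<forall>U s. trans_set E U \<longrightarrow> (sat E (ext E U) s \<phi> \<longleftrightarrow> P U)"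
  using assms unfolding definable_def L_in_def by auto

section \<open>The dial and the buttons\<close>

primrec depth_ge :: "nat \<Rightarrow> 'v \<Rightarrow> bool" where
  "depth_ge 0 x \<longleftrightarrow> True"
| "depth_ge (Suc k) x \<longleftrightarrow> (\<exists>y. x = succ y \<and> depth_ge k y)"

text \<open>The index is a natural number of the metatheory. A set may have no exact depth: a
  nonstandard natural number of the model can be peeled any standard number of times.\<close>

definition depth_eq :: "nat \<Rightarrow> 'v \<Rightarrow> bool" where
  "depth_eq k x \<longleftrightarrow> depth_ge k x \<and> \<not> depth_ge (Suc k) x"

lemma depth_ge_Suc_succ [simp]: "depth_ge (Suc k) (succ x) \<longleftrightarrow> depth_ge k x"
  by (auto dest: succ_inject)

lemma depth_ge_antimono: "depth_ge k x \<Longrightarrow> j \<le> k \<Longrightarrow> depth_ge j x"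
proof (induction k arbitrary: j x)
  case (Suc k)
  then show ?case by (cases j) auto
qed simp

lemma depth_eq_unique: "depth_eq j x \<Longrightarrow> depth_eq k x \<Longrightarrow> j = k"
  unfolding depth_eq_def using depth_ge_antimono by (metis Suc_leI linorder_neqE_nat)

lemma depth_eq_Suc_succ [simp]: "depth_eq (Suc k) (succ x) \<longleftrightarrow> depth_eq k x"
  unfolding depth_eq_def by (simp only: depth_ge_Suc_succ)

lemma depth_eq_emp: "depth_eq 0 emp"
  unfolding depth_eq_def using mem_emp mem_succ by (metis depth_ge.simps)

section \<open>Absoluteness and definability of successors and singletons\<close>

lemma trans_mem: "trans_set E U \<Longrightarrow> E x U \<Longrightarrow> E z x \<Longrightarrow> E z U"
  unfolding trans_set_def by blast

text \<open>In a transitive world the elements of a member are members again, so quantifiers over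
  the world suffice to test equality.\<close>

lemma set_eqI_within:
  assumes "\<And>z. E z x \<Longrightarrow> E z U" "\<And>z. E z y \<Longrightarrow> E z U"
    "\<And>z. E z U \<Longrightarrow> E z x \<longleftrightarrow> E z y"
  shows "x = y"
  by (rule set_eqI) (use assms in blast)

lemma eq_succ_iff:
  assumes "trans_set E U" "E x U"
  shows "x = succ y \<longleftrightarrow> E y U \<and> (\<forall>z. E z U \<longrightarrow> (E z x \<longleftrightarrow> E z y \<or> z = y))"
proof
  assume "x = succ y"
  then show "E y U \<and> (\<forall>z. E z U \<longrightarrow> (E z x \<longleftrightarrow> E z y \<or> z = y))"
    using trans_mem[OF assms] by simp
next
  assume *: "E y U \<and> (\<forall>z. E z U \<longrightarrow> (E z x \<longleftrightarrow> E z y \<or> z = y))"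
  then have "E z U" if "E z (succ y)" for z
    using that trans_mem[OF assms(1), of y z] by auto
  then show "x = succ y"
    using * by (intro set_eqI_within[OF trans_mem[OF assms]]) simp_all
qed

lemma eq_sing_iff:
  assumes "trans_set E U" "E a U"
  shows "a = sing x \<longleftrightarrow> E x U \<and> (\<forall>z. E z U \<longrightarrow> (E z a \<longleftrightarrow> z = x))"
proof
  assume "a = sing x"
  then show "E x U \<and> (\<forall>z. E z U \<longrightarrow> (E z a \<longleftrightarrow> z = x))"
    using trans_mem[OF assms] by simp
next
  assume *: "E x U \<and> (\<forall>z. E z U \<longrightarrow> (E z a \<longleftrightarrow> z = x))"
  then show "a = sing x"
    by (intro set_eqI_within[OF trans_mem[OF assms]]) auto
qed

text \<open>The variable \<open>n\<close> is arbitrary in the induction because the predecessor is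
  stored in \<open>Suc n\<close>; the next variable serves for the comparison of elements.\<close>

lemma definable_depth_ge: "definable {n} (\<lambda>U s. depth_ge k (s n))"
proof (induction k arbitrary: n)
  case 0
  then show ?case by (simp add: definable_const)
next
  case (Suc k)
  let ?z = "Suc (Suc n)"
  have "definable {?z, Suc n, n}
      (\<lambda>U s. E (s ?z) (s n) \<longleftrightarrow> E (s ?z) (s (Suc n)) \<or> s ?z = s (Suc n))"
    by (intro definable_iff definable_disj definable_Mem definable_Eq) auto
  from definable_all[OF this]
  have "definable {Suc n, n} (\<lambda>U s. depth_ge k (s (Suc n)) \<and>
      (\<forall>z. E z U \<longrightarrow> (E z (s n) \<longleftrightarrow> E z (s (Suc n)) \<or> z = s (Suc n))))"
    by (intro definable_conj definable_mono[OF Suc.IH]) auto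
  from definable_ex[OF this]
  have "definable {n} (\<lambda>U s. \<exists>y. E y U \<and> depth_ge k y \<and>
      (\<forall>z. E z U \<longrightarrow> (E z (s n) \<longleftrightarrow> E z y \<or> z = y)))" by simp
  then show ?case
  proof (rule definable_cong)
    fix U s assume U: "trans_set E U" "\<forall>i\<in>{n}. E (s i) U"
    then have "s n = succ y \<longleftrightarrow> E y U \<and> (\<forall>z. E z U \<longrightarrow> (E z (s n) \<longleftrightarrow> E z y \<or> z = y))" for y
      by (intro eq_succ_iff) auto
    then show "(\<exists>y. E y U \<and> depth_ge k y \<and>
      (\<forall>z. E z U \<longrightarrow> (E z (s n) \<longleftrightarrow> E z y \<or> z = y))) \<longleftrightarrow> depth_ge (Suc k) (s n)"
      by auto
  qed
qed

lemma definable_depth_eq: "definable {n} (\<lambda>U s. depth_eq k (s n))"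
  unfolding depth_eq_def by (intro definable_conj definable_not definable_depth_ge)

text \<open>The world is not one of its own elements, so being a successor is expressed by an
  element \<open>y\<close> that contains every other element. The reverse inclusion comes from
  transitivity.\<close>

lemma definable_world_depth_ge: "definable {} (\<lambda>U s. depth_ge k U)"
proof (cases k)
  case 0
  then show ?thesis by (simp add: definable_const)
next
  case (Suc j)
  have "definable {Suc 0, 0} (\<lambda>U s. E (s (Suc 0)) (s 0) \<or> s (Suc 0) = s 0)"
    by (intro definable_disj definable_Mem definable_Eq) auto
  from definable_all[OF this]
  have "definable {0} (\<lambda>U s. depth_ge j (s 0) \<and> (\<forall>z. E z U \<longrightarrow> E z (s 0) \<or> z = s 0))"
    by (intro definable_conj definable_depth_ge) auto
  from definable_ex[OF this]
  have "definable {} (\<lambda>U s. \<exists>y. E y U \<and> depth_ge j y \<and> (\<forall>z. E z U \<longrightarrow> E z y \<or> z = y))"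
    by simp
  then show ?thesis
  proof (rule definable_cong)
    fix U s assume U: "trans_set E U"
    have "U = succ y \<longleftrightarrow> E y U \<and> (\<forall>z. E z U \<longrightarrow> E z y \<or> z = y)" for y
    proof
      assume *: "E y U \<and> (\<forall>z. E z U \<longrightarrow> E z y \<or> z = y)"
      show "U = succ y"
        by (rule set_eqI) (use * trans_mem[OF U, of y] in auto)
    qed auto
    then show "(\<exists>y. E y U \<and> depth_ge j y \<and> (\<forall>z. E z U \<longrightarrow> E z y \<or> z = y)) \<longleftrightarrow>
        depth_ge k U"
      using Suc by auto
  qed
qed

lemma definable_world_depth_eq: "definable {} (\<lambda>U s. depth_eq k U)"
  unfolding depth_eq_def by (intro definable_conj definable_not definable_world_depth_ge)

text \<open>The index starts at depth 1 on purpose: depth 0 would admit {{\<open>emp\<close>}}, the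
  singleton of the transitive set {\<open>emp\<close>}, and resetting the dial could then press a
  button.\<close>

definition is_button :: "nat \<Rightarrow> 'v \<Rightarrow> bool" where
  "is_button i a \<longleftrightarrow> (\<exists>y. a = sing (sing y) \<and> depth_eq (Suc i) y)"

definition pressed :: "nat \<Rightarrow> 'v \<Rightarrow> bool" where
  "pressed i U \<longleftrightarrow> (\<exists>a. E a U \<and> is_button i a)"

lemma definable_pressed: "definable {} (\<lambda>U s. pressed i U)"
proof -
  have sing: "definable {m, n} (\<lambda>U s. s m = sing (s n))" if "m \<noteq> n" for m n
  proof -
    define k where "k = Suc (m + n)"
    have k: "k \<noteq> m" "k \<noteq> n" by (auto simp: k_def)
    have "definable {k, m, n} (\<lambda>U s. E (s k) (s m) \<longleftrightarrow> s k = s n)"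
      by (intro definable_iff definable_Mem definable_Eq) auto
    from definable_all[OF this] show ?thesis
      by (rule definable_cong) (use k in \<open>simp add: eq_sing_iff\<close>)
  qed
  have "definable {2, 1, 0} (\<lambda>U s. s 0 = sing (s 1) \<and> s 1 = sing (s 2) \<and> depth_eq (Suc i) (s 2))"
    by (intro definable_conj definable_mono[OF sing] definable_mono[OF definable_depth_eq]) auto
  from definable_ex[OF definable_ex[OF definable_ex[OF this]]]
  have "definable {} (\<lambda>U s. \<exists>a. E a U \<and> (\<exists>x. E x U \<and> (\<exists>y. E y U \<and>
      a = sing x \<and> x = sing y \<and> depth_eq (Suc i) y)))"
    by simp
  then show ?thesis
  proof (rule definable_cong)
    fix U s assume "trans_set E U"
    then have "E x U \<and> E y U" if "E a U" "a = sing x" "x = sing y" for a x y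
      using that unfolding trans_set_def by (metis mem_sing)
    then show "(\<exists>a. E a U \<and> (\<exists>x. E x U \<and> (\<exists>y. E y U \<and>
      a = sing x \<and> x = sing y \<and> depth_eq (Suc i) y))) \<longleftrightarrow> pressed i U"
      unfolding pressed_def is_button_def by metis
  qed
qed

lemma pressed_mono: "ext E U \<subseteq> ext E U' \<Longrightarrow> pressed i U \<Longrightarrow> pressed i U'"
  unfolding pressed_def ext_def by auto

lemma pressed_adj: "pressed i (adj U a) \<longleftrightarrow> pressed i U \<or> is_button i a"
  unfolding pressed_def by auto

lemma not_pressed_emp: "\<not> pressed i emp"
  unfolding pressed_def by simp

text \<open>Transitivity of {{y}} would put y into {{y}}, so y = {y}, against irreflexivity.\<close>

lemma trans_not_button:
  assumes "trans_set E a"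
  shows "\<not> is_button i a"
proof
  assume "is_button i a"
  then obtain y where "a = sing (sing y)" unfolding is_button_def by blast
  then have "y = sing y" using assms unfolding trans_set_def by (metis mem_sing)
  then show False using mem_irrefl mem_sing by metis
qed

lemma sing_inject: "sing x = sing y \<Longrightarrow> x = y"
  by (metis mem_sing)

text \<open>If {y} is transitive and y is the successor of z, then z lies in {y}, so z = y although
  z is in y. This uses that y has depth at least 1.\<close>

lemma sing_trans_not_button:
  assumes "trans_set E x"
  shows "\<not> is_button i (sing x)"
proof
  assume "is_button i (sing x)"
  then obtain y where y: "x = sing y" "depth_eq (Suc i) y"
    unfolding is_button_def by (blast dest: sing_inject)
  then obtain z where "y = succ z" unfolding depth_eq_def by auto
  then have "E z y" by simp
  then have "z = y" using assms y(1) unfolding trans_set_def by (metis mem_sing)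
  then show False using \<open>E z y\<close> mem_irrefl by blast
qed

lemma is_button_unique: "is_button i a \<Longrightarrow> is_button j a \<Longrightarrow> i = j"
  unfolding is_button_def using depth_eq_unique sing_inject by blast

lemma turn_dial:
  assumes U: "trans_set E U"
  shows "\<exists>U'. trans_set E U' \<and> ext E U \<subseteq> ext E U' \<and> depth_eq k U' \<and>
    (\<forall>i. pressed i U' \<longleftrightarrow> pressed i U)"
proof (induction k)
  case 0
  \<comment> \<open>Passing to the successor first makes \<open>A\<close> nonempty. From the empty
    set, the reset would give {\<open>emp\<close>, {\<open>emp\<close>}}, which is itself a
    successor.\<close>
  define A where "A = succ U"
  define B where "B = adj (succ A) (sing A)"
  have A: "trans_set E A" unfolding A_def by (rule trans_succ[OF U])
  have B: "trans_set E B" unfolding B_def by (rule trans_adj[OF trans_succ[OF A]]) simp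
  have memB: "E z B \<longleftrightarrow> E z A \<or> z = A \<or> z = sing A" for z by (auto simp: B_def)
  \<comment> \<open>Such a \<open>y\<close> would contain all other elements of \<open>B\<close>. A
    member of \<open>A\<close> cannot contain \<open>A\<close>, \<open>A\<close> does not contain
    {\<open>A\<close>}, and {\<open>A\<close>} does not contain \<open>U\<close>.\<close>
  have "B \<noteq> succ y" for y
  proof
    assume eq: "B = succ y"
    then have y: "E y B" "\<And>z. E z B \<Longrightarrow> E z y \<or> z = y" by auto
    have AsA: "E A (sing A)" "A \<noteq> sing A" by (simp, metis mem_irrefl mem_sing)
    consider "E y A" | "y = A" | "y = sing A" using y(1) memB by blast
    then show False
    proof cases
      case 1
      then show False using y(2)[of A] memB mem_asym by blast
    next
      case 2
      then show False using y(2)[of "sing A"] memB mem_asym AsA by metis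
    next
      case 3
      have "E U A" by (simp add: A_def)
      then have "U = A \<or> U = sing A" using 3 y(2)[of U] memB by auto
      then show False using \<open>E U A\<close> mem_irrefl mem_asym AsA(1) by metis
    qed
  qed
  then have "depth_eq 0 B" by (simp add: depth_eq_def)
  moreover have "ext E U \<subseteq> ext E B" by (auto simp: ext_def memB A_def)
  moreover have "pressed i B \<longleftrightarrow> pressed i U" for i
    using trans_not_button[OF U] trans_not_button[OF A] sing_trans_not_button[OF A]
    by (simp add: B_def pressed_adj succ_def[of A] A_def[unfolded succ_def] succ_def)
  ultimately show ?case using B by blast
next
  case (Suc k)
  then obtain U' where U': "trans_set E U'" "ext E U \<subseteq> ext E U'" "depth_eq k U'"
    "\<forall>i. pressed i U' \<longleftrightarrow> pressed i U" by blast
  have "pressed i (succ U') \<longleftrightarrow> pressed i U" for i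
    using U'(4) trans_not_button[OF U'(1)] by (simp add: succ_def pressed_adj)
  then show ?case
    using U' trans_succ ext_succ by (metis depth_eq_Suc_succ subset_trans)
qed

section \<open>Numerals as witnesses for pressing buttons\<close>

primrec num :: "nat \<Rightarrow> 'v" where
  "num 0 = emp"
| "num (Suc k) = succ (num k)"

lemma trans_num: "trans_set E (num k)"
  by (induction k) (auto intro: trans_emp trans_succ)

lemma depth_eq_num: "depth_eq k (num k)"
  by (induction k) (auto simp: depth_eq_emp)

lemma add_num:
  assumes U: "trans_set E U"
  shows "\<exists>U'. trans_set E U' \<and> ext E U \<subseteq> ext E U' \<and> E (num k) U' \<and>
    (\<forall>i. pressed i U' \<longleftrightarrow> pressed i U)"
proof (induction k)
  case 0
  have "trans_set E (adj U emp)" by (rule trans_adj[OF U]) simp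
  then show ?case
    using ext_adj trans_not_button[OF trans_emp]
    by (intro exI[of _ "adj U emp"]) (simp add: pressed_adj)
next
  case (Suc k)
  then obtain U' where U': "trans_set E U'" "ext E U \<subseteq> ext E U'" "E (num k) U'"
    "\<forall>i. pressed i U' \<longleftrightarrow> pressed i U" by blast
  let ?U = "adj U' (num (Suc k))"
  have "trans_set E ?U"
    by (rule trans_adj[OF U'(1)]) (use U'(1,3) in \<open>auto simp: trans_set_def\<close>)
  moreover have "ext E U \<subseteq> ext E ?U" using U'(2) ext_adj by blast
  moreover have "pressed i ?U \<longleftrightarrow> pressed i U" for i
    using U'(4) trans_not_button[OF trans_num] by (metis pressed_adj)
  ultimately show ?case by (intro exI[of _ ?U]) simp
qed

text \<open>Once the numeral is present, its singleton and double singleton are adjoined. Only the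
  latter is a button, and uniqueness of depth makes it the button \<open>i\<close> alone.\<close>

lemma press_button:
  assumes U: "trans_set E U"
  shows "\<exists>U'. trans_set E U' \<and> ext E U \<subseteq> ext E U' \<and>
    (\<forall>j. pressed j U' \<longleftrightarrow> pressed j U \<or> j = i)"
proof -
  let ?n = "num (Suc i)"
  obtain A where A: "trans_set E A" "ext E U \<subseteq> ext E A" "E ?n A"
    "\<forall>i. pressed i A \<longleftrightarrow> pressed i U" using add_num[OF U] by blast
  let ?B = "adj A (sing ?n)"
  let ?C = "adj ?B (sing (sing ?n))"
  have B: "trans_set E ?B" by (rule trans_adj[OF A(1)]) (use A(3) in \<open>simp only: mem_sing\<close>)
  have C: "trans_set E ?C" by (rule trans_adj[OF B]) simp
  have btn: "is_button i (sing (sing ?n))"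
    unfolding is_button_def using depth_eq_num by blast
  then have "is_button j (sing (sing ?n)) \<longleftrightarrow> j = i" for j
    using is_button_unique by blast
  then have "pressed j ?C \<longleftrightarrow> pressed j U \<or> j = i" for j
    using A(4) sing_trans_not_button[OF trans_num] by (simp only: pressed_adj) blast
  moreover have "ext E U \<subseteq> ext E ?C" using A(2) ext_adj by blast
  ultimately show ?thesis using C by blast
qed


section \<open>Labelling the worlds by a finite frame\<close>

text \<open>A world is seen only through two subsets of the finite frame, so every labelling
  computed from them is definable. For injective \<open>d\<close> this one has at most one
  element.\<close>

definition dial_info :: "'w set \<Rightarrow> ('w \<Rightarrow> nat) \<Rightarrow> 'v \<Rightarrow> 'w set" where
  "dial_info X d U = {x\<in>X. depth_eq (d x) U}"

definition button_info :: "'w set \<Rightarrow> ('w \<Rightarrow> nat) \<Rightarrow> 'v \<Rightarrow> 'w set" where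
  "button_info X e U = {x\<in>X. pressed (e x) U}"

lemma dial_info_eq:
  assumes "inj_on d X" "x \<in> X" "depth_eq (d x) U"
  shows "dial_info X d U = {x}"
  using assms depth_eq_unique unfolding dial_info_def inj_on_def by blast

lemma info_sentence:
  assumes "finite X"
  shows "\<exists>\<phi> \<in> L_in. \<forall>U s. trans_set E U \<longrightarrow>
    (sat E (ext E U) s \<phi> \<longleftrightarrow> F (button_info X e U) (dial_info X d U))"
  unfolding button_info_def dial_info_def
  by (intro definable_sentence definable_of_finite_info assms
      definable_pressed definable_world_depth_eq)

lemma not_valid_by_labelling:
  assumes fin: "finite X" and W: "trans_set E W"
    and in_X: "\<And>U. trans_set E U \<Longrightarrow> ext E W \<subseteq> ext E U \<Longrightarrow>
      F (button_info X e U) (dial_info X d U) \<in> X"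
    and zig: "\<And>U U'. trans_set E U \<Longrightarrow> trans_set E U' \<Longrightarrow> ext E W \<subseteq> ext E U \<Longrightarrow>
      ext E U \<subseteq> ext E U' \<Longrightarrow>
      R (F (button_info X e U) (dial_info X d U)) (F (button_info X e U') (dial_info X d U'))"
    and zag: "\<And>U y. trans_set E U \<Longrightarrow> ext E W \<subseteq> ext E U \<Longrightarrow> y \<in> X \<Longrightarrow>
      R (F (button_info X e U) (dial_info X d U)) y \<Longrightarrow>
      \<exists>U'. trans_set E U' \<and> ext E U \<subseteq> ext E U' \<and> F (button_info X e U') (dial_info X d U') = y"
    and p: "\<not> ksat X R V (F (button_info X e W) (dial_info X d W)) p"
  shows "p \<notin> Val E W L_in"
proof -
  let ?l = "\<lambda>U. F (button_info X e U) (dial_info X d U)"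
  have "\<forall>n. \<exists>\<phi> \<in> L_in. \<forall>U s. trans_set E U \<longrightarrow> (sat E (ext E U) s \<phi> \<longleftrightarrow> V n (?l U))"
    using info_sentence[OF fin, where F = "\<lambda>a b. V n (F a b)" for n] by blast
  then obtain \<sigma> where \<sigma>: "\<And>n. \<sigma> n \<in> L_in"
    and sat: "\<And>n U s. trans_set E U \<Longrightarrow> sat E (ext E U) s (\<sigma> n) \<longleftrightarrow> V n (?l U)"
    by metis
  have "sat E (ext E W) s (inst \<sigma> p) \<longleftrightarrow> ksat X R V (?l W) p" for s
    by (rule sat_p_morphism[where l = ?l and W = W])
      (assumption | rule W order_refl in_X zig zag sat)+
  then have "\<not> true_at E W (inst \<sigma> p)" using p by (simp add: true_at_def)
  then show ?thesis using \<sigma> by (auto simp: Val_def)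
qed

text \<open>A single cluster needs no buttons: \<open>F\<close> ignores its first argument, and
  turning the dial reaches every node from every world.\<close>

lemma Val_subset_S5:
  assumes W: "trans_set E W"
  shows "Val E W L_in \<subseteq> S5"
proof
  fix p assume val: "p \<in> Val E W L_in"
  show "p \<in> S5"
  proof (rule ccontr)
    assume "p \<notin> S5"
    then obtain X :: "pm set set" and r R V where X: "finite X" "r \<in> X"
      and R0: "\<forall>x\<in>X. \<forall>y\<in>X. R x y" and p: "\<not> ksat X R V r p"
      by (rule S5_countermodel)
    note R = R0[rule_format]
    obtain e :: "pm set \<Rightarrow> nat" where e: "inj_on e X"
      using finite_imp_inj_to_nat_seg[OF X(1)] by blast
    \<comment> \<open>The dial is relabelled so that its position at \<open>W\<close>, if there is one, means \<open>r\<close>.\<close>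
    define k where "k = (SOME k. depth_eq k W)"
    define d where "d x = (if x = r then k else Suc (k + e x))" for x
    have d: "inj_on d X" using e by (auto simp: inj_on_def d_def)
    \<comment> \<open>Worlds whose dial selects no node are labelled \<open>r\<close> by default;
      this also settles a \<open>W\<close> without exact depth.\<close>
    define F :: "pm set set \<Rightarrow> pm set set \<Rightarrow> pm set"
      where "F a b = (if \<exists>x\<in>X. b = {x} then the_elem b else r)" for a b
    have F: "F a b \<in> X" for a b using X(2) by (auto simp: F_def)
    have "F (button_info X e W) (dial_info X d W) = r"
    proof (cases "\<exists>j. depth_eq j W")
      case True
      then have "depth_eq (d r) W" by (auto simp: d_def k_def intro: someI)
      then show ?thesis using dial_info_eq[OF d X(2)] by (simp add: F_def)
    next
      case False
      then show ?thesis by (simp add: F_def dial_info_def)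
    qed
    then have pW: "\<not> ksat X R V (F (button_info X e W) (dial_info X d W)) p"
      using p by simp
    have zag: "\<exists>U'. trans_set E U' \<and> ext E U \<subseteq> ext E U' \<and>
        F (button_info X e U') (dial_info X d U') = y"
      if "trans_set E U" "y \<in> X" for U y
    proof -
      obtain U' where "trans_set E U'" "ext E U \<subseteq> ext E U'" "depth_eq (d y) U'"
        using turn_dial[OF \<open>trans_set E U\<close>] by blast
      then show ?thesis
        using dial_info_eq[OF d \<open>y \<in> X\<close>] \<open>y \<in> X\<close> by (intro exI[of _ U']) (simp add: F_def)
    qed
    have "p \<notin> Val E W L_in"
      by (rule not_valid_by_labelling[where R = R and F = F, OF X(1) W _ _ _ pW])
        (assumption | rule F R zag)+
    then show False using val by blast
  qed
qed

section \<open>The sharp bound at the empty world\<close>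

lemma finite_chain_has_greatest:
  assumes "finite B" "B \<noteq> {}" "\<And>x. x \<in> B \<Longrightarrow> R x x" "\<And>x y z. R x y \<Longrightarrow> R y z \<Longrightarrow> R x z"
    and "\<And>x y. x \<in> B \<Longrightarrow> y \<in> B \<Longrightarrow> R x y \<or> R y x"
  shows "\<exists>g\<in>B. \<forall>y\<in>B. R y g"
proof -
  obtain x0 where "x0 \<in> B" using assms(2) by blast
  moreover have "\<exists>z\<in>B. R x z \<and> R y z" if "x \<in> B" "y \<in> B" for x y
    using assms(3,5) that by blast
  ultimately show ?thesis
    using finite_directed_upper_bound[OF assms(1) order_refl, of x0 R] assms(4) by blast
qed

lemma Val_emp_subset_S42: "Val E emp L_in \<subseteq> S42"
proof
  fix p assume val: "p \<in> Val E emp L_in"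
  show "p \<in> S42"
  proof (rule ccontr)
    assume "p \<notin> S42"
    then obtain X :: "pm set set" and r t R V where X: "finite X" "r \<in> X" "t \<in> X"
      and R0: "\<forall>x\<in>X. R x x" "\<forall>x y z. R x y \<longrightarrow> R y z \<longrightarrow> R x z"
        "\<forall>x\<in>X. R x t"
      and p: "\<not> ksat X R V r p"
      by (rule S42_countermodel)
    note refl = R0(1)[rule_format] and trans = R0(2)[rule_format] and top = R0(3)[rule_format]
    obtain e :: "pm set \<Rightarrow> nat" where e: "inj_on e X"
      using finite_imp_inj_to_nat_seg[OF X(1)] by blast
    \<comment> \<open>Position 0 belongs to \<open>r\<close> because \<open>emp\<close> has depth
      0.\<close>
    define d where "d x = (if x = r then 0 else Suc (e x))" for x
    have d: "inj_on d X" using e by (auto simp: inj_on_def d_def)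
    define chain where "chain B \<longleftrightarrow> (\<forall>x\<in>B. \<forall>y\<in>B. R x y \<or> R y x)" for B
    \<comment> \<open>\<open>G\<close> picks a representative of the current cluster. Inserting
      \<open>r\<close> gives a value when nothing is pressed; failure of the chain condition is
      permanent and sends the world to the top.\<close>
    define G where "G a = (if chain (insert r a)
      then SOME g. g \<in> insert r a \<and> (\<forall>y\<in>insert r a. R y g) else t)" for a
    \<comment> \<open>The dial counts only if it selects a node equivalent to \<open>G a\<close>;
      otherwise \<open>G a\<close> itself is the label.\<close>
    define F where "F a b = (if \<exists>x\<in>X. b = {x} \<and> R x (G a) \<and> R (G a) x then the_elem b else G a)"
      for a b
    have G: "G a \<in> insert r a" "\<And>y. y \<in> insert r a \<Longrightarrow> R y (G a)"
      if "a \<subseteq> X" "chain (insert r a)" for a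
    proof -
      have "\<exists>g\<in>insert r a. \<forall>y\<in>insert r a. R y g"
        using that X refl trans finite_subset[OF \<open>a \<subseteq> X\<close> X(1)]
        by (intro finite_chain_has_greatest) (auto simp: chain_def)
      then have "\<exists>g. g \<in> insert r a \<and> (\<forall>y\<in>insert r a. R y g)" by blast
      from someI_ex[OF this] show "G a \<in> insert r a" "\<And>y. y \<in> insert r a \<Longrightarrow> R y (G a)"
        using that(2) unfolding G_def if_P[OF that(2)] by blast+
    qed
    have GX: "G a \<in> X" if "a \<subseteq> X" for a
      using G(1)[OF that] that X by (cases "chain (insert r a)") (auto simp: G_def)
    have GF: "F a b \<in> X" "R (G a) (F a b)" "R (F a b) (G a)" if "a \<subseteq> X" for a b
      using GX[OF that] refl by (auto simp: F_def)
    \<comment> \<open>Subsets of chains are chains, so if the larger set is a chain then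
      \<open>G a\<close> is one of its members and lies below its greatest element; if not, the
      label is the top.\<close>
    have G_mono: "R (G a) (G a')" if "a \<subseteq> a'" "a' \<subseteq> X" for a a'
    proof (cases "chain (insert r a')")
      case True
      then have "chain (insert r a)" using that(1) unfolding chain_def by blast
      then have "G a \<in> insert r a'" using G(1)[of a] that by blast
      then show ?thesis using G(2)[OF that(2) True] by blast
    next
      case False
      then show ?thesis using GX[of a] top that by (auto simp: G_def)
    qed
    have sub: "button_info X e U \<subseteq> X" for U by (auto simp: button_info_def)
    let ?l = "\<lambda>U. F (button_info X e U) (dial_info X d U)"
    have zig: "R (?l U) (?l U')" if "ext E U \<subseteq> ext E U'" for U U'
    proof -
      have "button_info X e U \<subseteq> button_info X e U'"
        using pressed_mono[OF that] by (auto simp: button_info_def)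
      then show ?thesis using G_mono GF sub trans by meson
    qed
    have zag: "\<exists>U'. trans_set E U' \<and> ext E U \<subseteq> ext E U' \<and> ?l U' = y"
      if U: "trans_set E U" and y: "y \<in> X" "R (?l U) y" for U y
    proof -
      let ?a = "button_info X e U"
      have Gy: "R (G ?a) y" using GF(2)[OF sub] y(2) trans by blast
      \<comment> \<open>First the cluster is moved to that of \<open>y\<close>. Over a chain, the
        button of \<open>y\<close> is pressed: \<open>y\<close> lies above all pressed nodes, so the
        chain survives with \<open>y\<close> as a greatest element. Otherwise \<open>y\<close> is
        above \<open>t\<close> and already in the top cluster.\<close>
      obtain U1 where U1: "trans_set E U1" "ext E U \<subseteq> ext E U1"
        "R y (G (button_info X e U1))" "R (G (button_info X e U1)) y"
      proof (cases "chain (insert r ?a)")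
        case True
        obtain U1 where U1: "trans_set E U1" "ext E U \<subseteq> ext E U1"
          "\<forall>j. pressed j U1 \<longleftrightarrow> pressed j U \<or> j = e y"
          using press_button[OF U] by blast
        have a1: "button_info X e U1 = insert y ?a"
          using U1(3) e y(1) by (auto simp: button_info_def inj_on_def)
        have le: "R z y" if "z \<in> insert r (insert y ?a)" for z
          using that G(2)[OF sub True] Gy trans refl[OF y(1)] by blast
        then have ch: "chain (insert r (insert y ?a))"
          using True unfolding chain_def by blast
        have a1X: "insert y ?a \<subseteq> X" using sub y(1) by blast
        show ?thesis
          using that[OF U1(1,2)] G[OF a1X ch] le by (simp add: a1)
      next
        case False
        then have "G ?a = t" by (simp add: G_def)
        then show ?thesis using that[OF U order_refl] top[OF y(1)] Gy by simp
      qed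
      \<comment> \<open>The dial comes last, because pressing a button may disturb it while turning
        it presses nothing.\<close>
      obtain U2 where U2: "trans_set E U2" "ext E U1 \<subseteq> ext E U2" "depth_eq (d y) U2"
        "\<forall>i. pressed i U2 \<longleftrightarrow> pressed i U1"
        using turn_dial[OF U1(1)] by blast
      have "button_info X e U2 = button_info X e U1" using U2(4) by (simp add: button_info_def)
      then have "?l U2 = y"
        using dial_info_eq[OF d y(1) U2(3)] U1(3,4) y(1) by (simp add: F_def)
      then show ?thesis using U1(2) U2(1,2) by blast
    qed
    have "button_info X e emp = {}" by (simp add: button_info_def not_pressed_emp)
    moreover have "dial_info X d emp = {r}"
      by (rule dial_info_eq[OF d X(2)]) (simp add: d_def depth_eq_emp)
    moreover have "G {} = r"
      using G(1)[of "{}"] refl[OF X(2)] by (simp add: chain_def)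
    ultimately have "?l emp = r"
      using refl[OF X(2)] X(2) by (simp add: F_def)
    then have pW: "\<not> ksat X R V (?l emp) p" using p by simp
    have "p \<notin> Val E emp L_in"
      by (rule not_valid_by_labelling[where R = R and F = F, OF X(1) trans_emp _ _ _ pW])
        (assumption | rule GF(1) sub zig zag)+
    then show False using val by blast
  qed
qed

end

lemma Val_antimono: "L \<subseteq> L' \<Longrightarrow> Val E W L' \<subseteq> Val E W L"
  unfolding Val_def by blast

theorem theorem24:
  fixes E :: "'v \<Rightarrow> 'v \<Rightarrow> bool"
  assumes "ZFC E"
  shows "(\<forall>W. trans_set E W \<longrightarrow>
            S42 \<subseteq> Val E W (L_dia_par E W) \<and>
            Val E W (L_dia_par E W) \<subseteq> Val E W L_in \<and>
            Val E W L_in \<subseteq> S5) \<and>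
         (\<exists>W. trans_set E W \<and>
            S42 = Val E W (L_dia_par E W) \<and>
            Val E W (L_dia_par E W) = Val E W L_in)"
proof -
  interpret ZFC E by (rule assms)
  have lower: "S42 \<subseteq> Val E W (L_dia_par E W)" if "trans_set E W" for W
    using S42_sound that by (auto simp: Val_def true_at_def)
  have middle: "Val E W (L_dia_par E W) \<subseteq> Val E W L_in" for W
    by (rule Val_antimono) (auto simp: L_in_def L_dia_par_def)
  have "S42 = Val E emp (L_dia_par E emp)" "Val E emp (L_dia_par E emp) = Val E emp L_in"
    using lower[OF trans_emp] middle[of emp] Val_emp_subset_S42 by auto
  then show ?thesis using lower middle Val_subset_S5 trans_emp by blast
qed

end
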